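(* Let $\alpha\in(0,\pi/2)$ and let $c$ be a real number with $c<2\alpha/\pi$. Then there exists a non-constant polynomial $P$ with non-negative real coefficients such that, with $d=\deg P$, the number of roots of $P$, counted with multiplicity, in the sector $\{z\in\mathbb{C}^*:|\mathrm{Arg}\, z|\le\alpha\}$ is strictly greater than $c\,d$. In other words, for no $\alpha\in(0,\pi/2)$ can the constant $2\alpha/\pi$ be replaced by a smaller number in the inequality $$\mu_P\{z\in\mathbb{C}^*:|\mathrm{Arg}\, z|\le\alpha\}\le\frac{2\alpha}{\pi}$$ for the empirical measures $\mu_P$ of all polynomials $P$ with non-negative coefficients.
   Context: $\mathbb{C}^*=\mathbb{C}\setminus\{0\}$, and $\mathrm{Arg}\, z\in(-\pi,\pi]$ is the principal argument of $z\in\mathbb{C}^*$. The empirical measure $\mu_P$ of a polynomial $P$ of degree $d\ge1$ is the probability measure on $\mathbb{C}$ consisting of an atom of mass $m/d$ at every root of $P$ of multiplicity $m$. *)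

theory Defs
  imports "HOL-Analysis.Analysis" "HOL-Computational_Algebra.Computational_Algebra"
begin

(* Arg 0 = 0 in the library, so the vertex must be excluded explicitly. *)
definition sector :: "real \<Rightarrow> complex set" where
  "sector \<alpha> = {z. z \<noteq> 0 \<and> \<bar>Arg z\<bar> \<le> \<alpha>}"

(* The atoms are given by a density on the discrete space; distr only restricts
   the resulting measure to the Borel sets. A probability measure when degree P >= 1. *)
definition empirical_measure :: "complex poly \<Rightarrow> complex measure" where
  "empirical_measure P =
     distr (point_measure UNIV
              (\<lambda>z. if poly P z = 0 then ennreal (real (order z P) / real (degree P)) else 0))
       borel (\<lambda>z. z)"

end

theory Submission
  imports Defs "HOL-Complex_Analysis.Conformal_Mappings" "HOL-Real_Asymp.Real_Asymp"
begin

text \<open>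
  Take \<open>\<gamma>\<close> slightly smaller than \<open>\<alpha>\<close>, put \<open>\<omega> = exp (2i\<gamma>)\<close>, and consider
  \<open>P\<^sub>n(z) = (1 + z)\<^sup>n + (1 + \<omega>z)\<^sup>n / 2 + (1 + z/\<omega>)\<^sup>n / 2\<close>, whose coefficients
  \<open>(n choose k) (1 + cos (2\<gamma>k))\<close> are non-negative.  On the ray of argument \<open>\<gamma>\<close>, away from its
  ends, the first and the last term have comparable size and the middle one is exponentially
  smaller, so that the zeros of \<open>P\<^sub>n\<close> near this ray are close to the solutions of
  \<open>2u\<^sup>n = -1\<close> where \<open>u = (1 + z) / (1 + z/\<omega>)\<close>.  As \<open>z\<close> runs through the ray, \<open>u\<close> runs through
  the arc of the unit circle from \<open>1\<close> to \<open>\<omega>\<close>; this gives about \<open>2\<gamma>n / 2\<pi>\<close> zeros, and with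
  their conjugates \<open>2\<gamma>n / \<pi>\<close> zeros in the sector.
\<close>

section \<open>Zeros of a perturbed power equation\<close>

text \<open>Beyond the linear term the binomial expansion has non-negative coefficients, so it is
  dominated termwise by its value at \<open>norm x\<close>. The induction shows this without
  expanding.\<close>

lemma norm_power_one_plus_diff_le:
  fixes x :: "'a :: real_normed_field"
  shows "norm ((1 + x) ^ n - 1 - of_nat n * x) \<le> (1 + norm x) ^ n - 1 - of_nat n * norm x"
proof (induction n)
  case (Suc n)
  have "(1 + x) ^ Suc n - 1 - of_nat (Suc n) * x
      = ((1 + x) ^ n - 1 - of_nat n * x) * (1 + x) + of_nat n * x ^ 2"
    by (simp add: algebra_simps power2_eq_square)
  also have "norm \<dots> \<le> ((1 + norm x) ^ n - 1 - of_nat n * norm x) * (1 + norm x)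
      + of_nat n * norm x ^ 2"
    by (rule order_trans[OF norm_triangle_ineq])
      (auto simp: norm_mult norm_power intro!: add_mono mult_mono Suc order_trans[OF norm_triangle_ineq]
         order_trans[OF norm_ge_zero Suc])
  also have "\<dots> = (1 + norm x) ^ Suc n - 1 - of_nat (Suc n) * norm x"
    by (simp add: algebra_simps power2_eq_square)
  finally show ?case .
qed simp

text \<open>The linear term has norm 1, and the remainder is at most \<open>(1 + 1/n)^n - 2\<close>,
  which is below 3/4 because e < 2.75.\<close>

lemma norm_power_one_plus_minus_one_ge:
  fixes x :: complex
  assumes "n > 0" and "norm x = 1 / n"
  shows "norm ((1 + x) ^ n - 1) > 1 / 4"
proof -
  have "(1 + 1 / real n) ^ n \<le> exp (1 / real n) ^ n"
    by (intro power_mono exp_ge_add_one_self) auto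
  also have "\<dots> = exp 1"
    using assms by (simp flip: exp_of_nat_mult)
  finally have 1: "(1 + 1 / real n) ^ n < 2.75"
    using e_less_272 by simp
  have "norm (of_nat n * x) \<le> norm ((1 + x) ^ n - 1) + norm ((1 + x) ^ n - 1 - of_nat n * x)"
    by (smt (verit) norm_triangle_ineq4 diff_diff_eq2 add_diff_cancel_left' add.commute)
  moreover have "norm (of_nat n * x) = 1"
    using assms by (simp add: norm_mult)
  ultimately show ?thesis
    using norm_power_one_plus_diff_le[of x n] 1 assms by simp
qed

text \<open>A Rouche-type argument: writing \<open>u = u0 * (1 + x)\<close> with
  \<open>norm x = 1/n\<close> on the circle, \<open>2 * u^n + 1\<close> becomes
  \<open>1 - (1 + x)^n\<close>, of modulus above 1/4. So the perturbed function exceeds 1/8 on the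
  circle but is below 1/8 at the centre, which forces a zero inside.\<close>

lemma perturbed_power_root:
  fixes E :: "complex \<Rightarrow> complex"
  assumes n: "n > 0" and u0: "2 * u0 ^ n = -1"
    and E: "E holomorphic_on UNIV"
    and small: "\<And>u. u \<in> cball u0 (norm u0 / n) \<Longrightarrow> norm (E u) < 1 / 8"
  obtains u where "u \<in> ball u0 (norm u0 / n)" and "2 * u ^ n + 1 + E u = 0"
proof (rule holomorphic_contract_to_zero[of u0 "norm u0 / n" "\<lambda>u. 2 * u ^ n + 1 + E u"])
  have [simp]: "u0 \<noteq> 0"
    using u0 n by (auto simp: power_0_left)
  show "0 < norm u0 / n"
    using n by simp
  have hol: "(\<lambda>u. 2 * u ^ n + 1 + E u) holomorphic_on UNIV"
    using E by (intro holomorphic_intros)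
  show "continuous_on (cball u0 (norm u0 / n)) (\<lambda>u. 2 * u ^ n + 1 + E u)"
    using holomorphic_on_imp_continuous_on[OF hol] continuous_on_subset by blast
  show "(\<lambda>u. 2 * u ^ n + 1 + E u) holomorphic_on ball u0 (norm u0 / n)"
    using hol holomorphic_on_subset by blast
  show "norm (2 * u0 ^ n + 1 + E u0) < norm (2 * z ^ n + 1 + E z)"
    if z: "norm (u0 - z) = norm u0 / n" for z
  proof -
    define x where "x = z / u0 - 1"
    have "x = - ((u0 - z) / u0)"
      by (simp add: x_def field_simps)
    hence "norm x = 1 / n"
      using z n by (simp add: norm_divide)
    hence "norm ((1 + x) ^ n - 1) > 1 / 4"
      using norm_power_one_plus_minus_one_ge n by blast
    moreover have "2 * z ^ n + 1 = - ((1 + x) ^ n - 1)"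
    proof -
      have "z ^ n = (1 + x) ^ n * u0 ^ n"
        by (simp add: x_def power_divide)
      moreover have "u0 ^ n = - 1 / 2"
        using u0 by (simp add: field_simps)
      ultimately show ?thesis by simp
    qed
    ultimately have "norm (2 * z ^ n + 1) > 1 / 4"
      by (metis norm_minus_cancel)
    moreover have "norm (E z) < 1 / 8" "norm (E u0) < 1 / 8"
      using z by (intro small; simp add: dist_norm)+
    moreover have "norm (2 * z ^ n + 1) \<le> norm (2 * z ^ n + 1 + E z) + norm (E z)"
      by (metis norm_triangle_ineq4 add_diff_cancel_right')
    ultimately show ?thesis
      using u0 by simp
  qed
qed (use that in blast)

section \<open>Chords of the unit circle and the sector\<close>

text \<open>A weak Jordan inequality, used to keep the discs around approximate roots disjoint. The
  derivative of sine is at least 1/2 up to pi/6; from there on sine itself is at least 1/2.\<close>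

lemma sin_ge_div_pi:
  fixes x :: real
  assumes "0 \<le> x" and "x \<le> pi / 2"
  shows "x / pi \<le> sin x"
proof (cases "x \<le> pi / 6")
  case True
  have "1 / 2 \<le> cos t" if "0 \<le> t" "t \<le> x" for t
    using cos_monotone_0_pi_le[of t "pi / 3"] that True by (simp add: cos_60)
  hence "\<exists>y. ((\<lambda>t. sin t - t / 2) has_real_derivative y) (at t) \<and> 0 \<le> y" if "0 \<le> t" "t \<le> x" for t
    using that by (intro exI[of _ "cos t - 1 / 2"]) (auto intro!: derivative_eq_intros)
  hence "sin 0 - 0 / 2 \<le> sin x - x / 2"
    using DERIV_nonneg_imp_nondecreasing[of 0 x "\<lambda>t. sin t - t / 2"] assms by blast
  moreover have "x / pi \<le> x / 2"
    using assms pi_gt3 by (intro divide_left_mono) auto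
  ultimately show ?thesis
    unfolding sin_zero by linarith
next
  case False
  have "x / pi \<le> 1 / 2"
    using assms by (simp add: field_simps)
  also have "1 / 2 \<le> sin x"
    using sin_monotone_2pi_le[of "pi / 6" x] False assms by (simp add: sin_30)
  finally show ?thesis .
qed

lemma cis_diff: "cis a - cis b = 2 * \<i> * of_real (sin ((a - b) / 2)) * cis ((a + b) / 2)"
proof -
  have "cis a - cis b = (cis ((a - b) / 2) - cis (- ((a - b) / 2))) * cis ((a + b) / 2)"
    by (simp add: left_diff_distrib cis_mult field_simps flip: add_divide_distrib)
  also have "cis ((a - b) / 2) - cis (- ((a - b) / 2)) = 2 * \<i> * of_real (sin ((a - b) / 2))"
    by (simp add: complex_eq_iff)
  finally show ?thesis .
qed

text \<open>Cosine decreases on [0, pi] and \<open>cos (Arg z) = Re z / norm z\<close>. This form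
  avoids the jump of \<open>Arg\<close>, so that topological properties and symmetry under
  conjugation can be read off.\<close>

lemma sector_eq:
  assumes "0 \<le> \<alpha>" and "\<alpha> \<le> pi"
  shows "sector \<alpha> = {z. z \<noteq> 0 \<and> norm z * cos \<alpha> \<le> Re z}"
proof -
  have "\<bar>Arg z\<bar> \<le> \<alpha> \<longleftrightarrow> norm z * cos \<alpha> \<le> Re z" if "z \<noteq> 0" for z
  proof -
    have "\<bar>Arg z\<bar> \<le> \<alpha> \<longleftrightarrow> cos \<alpha> \<le> cos \<bar>Arg z\<bar>"
      using assms Arg_bounded[of z] by (intro cos_mono_le_eq[symmetric]) auto
    also have "cos \<bar>Arg z\<bar> = Re z / norm z"
      using that by (simp add: cos_Arg)
    finally show ?thesis
      using that by (simp add: field_simps)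
  qed
  thus ?thesis
    by (auto simp: sector_def)
qed

lemma sector_borel:
  assumes "0 \<le> \<alpha>" and "\<alpha> \<le> pi"
  shows "sector \<alpha> \<in> sets borel"
proof -
  have "closed {z. norm z * cos \<alpha> \<le> Re z}"
    by (intro closed_Collect_le continuous_intros)
  hence "{z. norm z * cos \<alpha> \<le> Re z} - {0} \<in> sets borel"
    by auto
  also have "{z. norm z * cos \<alpha> \<le> Re z} - {0} = sector \<alpha>"
    using sector_eq[OF assms] by auto
  finally show ?thesis .
qed

section \<open>Root counts and the empirical measure\<close>

lemma size_filter_proots:
  fixes p :: "'a :: idom poly"
  assumes "p \<noteq> 0"
  shows "size {#z \<in># proots p. z \<in> S#} = (\<Sum>z | z \<in> S \<and> poly p z = 0. order z p)"
  using assms unfolding size_multiset_overloaded_eq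
  by (intro sum.cong) auto

text \<open>Only the finitely many roots carry mass, so the measure is a finite sum of atoms. This
  transfers the root count to the measure form of the theorem.\<close>

lemma measure_empirical_measure:
  assumes "degree p \<ge> 1" and S: "S \<in> sets borel"
  shows "measure (empirical_measure p) S = real (size {#z \<in># proots p. z \<in> S#}) / real (degree p)"
proof -
  have p: "p \<noteq> 0"
    using assms by auto
  define f where "f = (\<lambda>z. if poly p z = 0 then ennreal (real (order z p) / real (degree p)) else 0)"
  have pos: "0 < f z \<longleftrightarrow> poly p z = 0" for z
    using assms p order_gt_0_iff[of p z] by (auto simp: f_def zero_less_divide_iff)
  have "emeasure (empirical_measure p) S = emeasure (point_measure UNIV f) S"
    using S unfolding empirical_measure_def f_def[symmetric]
    by (subst emeasure_distr) (auto simp: space_point_measure)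
  also have "\<dots> = (\<Sum>z | z \<in> S \<and> 0 < f z. f z)"
    using poly_roots_finite[OF p] by (intro emeasure_point_measure) (auto simp: pos)
  also have "\<dots> = (\<Sum>z | z \<in> S \<and> poly p z = 0. ennreal (real (order z p) / real (degree p)))"
  proof (rule sum.cong)
    show "f z = ennreal (real (order z p) / real (degree p))" if "z \<in> {z. z \<in> S \<and> poly p z = 0}" for z
      using that by (simp add: f_def)
  qed (simp add: pos)
  also have "\<dots> = ennreal (\<Sum>z | z \<in> S \<and> poly p z = 0. real (order z p) / real (degree p))"
    by (intro sum_ennreal divide_nonneg_nonneg) auto
  also have "(\<Sum>z | z \<in> S \<and> poly p z = 0. real (order z p) / real (degree p))
      = real (size {#z \<in># proots p. z \<in> S#}) / real (degree p)"
    by (simp add: size_filter_proots[OF p] sum_divide_distrib)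
  finally show ?thesis
    by (simp add: measure_def)
qed

section \<open>The polynomial family and its form in the arc coordinate\<close>

definition rotated_binomial_poly :: "real \<Rightarrow> nat \<Rightarrow> real poly" where
  "rotated_binomial_poly \<gamma> n = (\<Sum>k\<le>n. monom (real (n choose k) * (1 + cos (2 * \<gamma> * k))) k)"

lemma coeff_rotated_binomial_poly:
  "coeff (rotated_binomial_poly \<gamma> n) k =
    (if k \<le> n then real (n choose k) * (1 + cos (2 * \<gamma> * k)) else 0)"
  by (simp add: rotated_binomial_poly_def coeff_sum if_distrib cong: if_cong)

lemma coeff_rotated_binomial_poly_nonneg: "coeff (rotated_binomial_poly \<gamma> n) k \<ge> 0"
proof -
  have "0 \<le> 1 + cos (2 * \<gamma> * real k)"
    using cos_ge_minus_one[of "2 * \<gamma> * real k"] by linarith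
  thus ?thesis
    by (simp add: coeff_rotated_binomial_poly)
qed

lemma rotated_binomial_poly_nonzero: "rotated_binomial_poly \<gamma> n \<noteq> 0"
proof
  assume "rotated_binomial_poly \<gamma> n = 0"
  hence "coeff (rotated_binomial_poly \<gamma> n) 0 = 0" by simp
  thus False by (simp add: coeff_rotated_binomial_poly)
qed

text \<open>Only an inequality, because the top coefficient
  \<open>1 + cos (2 * \<gamma> * n)\<close> can vanish.\<close>

lemma degree_rotated_binomial_poly_le: "degree (rotated_binomial_poly \<gamma> n) \<le> n"
  by (intro degree_le) (simp add: coeff_rotated_binomial_poly)

lemma poly_rotated_binomial_poly:
  "poly (map_poly complex_of_real (rotated_binomial_poly \<gamma> n)) z =
    (1 + z) ^ n + ((1 + z * cis (2 * \<gamma>)) ^ n + (1 + z * cis (- 2 * \<gamma>)) ^ n) / 2"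
proof -
  have binom: "(1 + z * w) ^ n = (\<Sum>k\<le>n. of_nat (n choose k) * w ^ k * z ^ k)" for w
    using binomial_ring[of "z * w" 1 n] by (simp add: power_mult_distrib algebra_simps)
  have "cis (2 * \<gamma>) ^ k + cis (- 2 * \<gamma>) ^ k = 2 * of_real (cos (2 * \<gamma> * k))" for k
    by (simp add: Complex.DeMoivre complex_eq_iff mult_ac)
  hence cos: "complex_of_real (cos (2 * \<gamma> * k)) = (cis (2 * \<gamma>) ^ k + cis (- 2 * \<gamma>) ^ k) / 2" for k
    by simp
  have "map_poly complex_of_real (rotated_binomial_poly \<gamma> n)
      = (\<Sum>k\<le>n. monom (of_nat (n choose k) * (1 + complex_of_real (cos (2 * \<gamma> * k)))) k)"
    by (intro poly_eqI) (simp add: coeff_map_poly coeff_rotated_binomial_poly coeff_sum if_distrib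
        cong: if_cong)
  \<comment> \<open>The factor \<open>z * 1\<close> lets \<open>binom\<close> expand the unrotated
    power as well.\<close>
  also have "poly \<dots> z = (1 + z * 1) ^ n + ((1 + z * cis (2 * \<gamma>)) ^ n + (1 + z * cis (- 2 * \<gamma>)) ^ n) / 2"
    unfolding cos binom
    by (simp add: poly_sum poly_monom sum_divide_distrib algebra_simps add_divide_distrib
        flip: sum.distrib)
  finally show ?thesis by simp
qed

text \<open>The inverse of \<open>z \<mapsto> (1 + z) / (1 + z / \<omega>)\<close>, where \<open>\<omega> = cis (2 * \<gamma>)\<close>; it maps the arc
  of the unit circle from \<open>1\<close> to \<open>\<omega>\<close> onto the ray of argument \<open>\<gamma>\<close>.\<close>
definition arc_to_ray :: "real \<Rightarrow> complex \<Rightarrow> complex" where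
  "arc_to_ray \<gamma> u = cis (2 * \<gamma>) * (u - 1) / (cis (2 * \<gamma>) - u)"

text \<open>Numerator and denominator are chords; \<open>cis_diff\<close> writes each as a sine
  times a unit vector, and the quotient of the unit vectors is \<open>cis \<gamma>\<close>.\<close>

lemma arc_to_ray_cis:
  assumes "0 < \<phi>" and "\<phi> < 2 * \<gamma>" and "\<gamma> < pi"
  shows "arc_to_ray \<gamma> (cis \<phi>) = of_real (sin (\<phi> / 2) / sin (\<gamma> - \<phi> / 2)) * cis \<gamma>"
proof -
  have "sin (\<gamma> - \<phi> / 2) > 0"
    using assms by (intro sin_gt_zero) auto
  moreover have "cis (2 * \<gamma>) - cis \<phi> = 2 * \<i> * of_real (sin (\<gamma> - \<phi> / 2)) * cis (\<gamma> + \<phi> / 2)"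
    using cis_diff[of "2 * \<gamma>" \<phi>] by (simp add: diff_divide_distrib add_divide_distrib)
  moreover have "cis (2 * \<gamma>) * (cis \<phi> - 1)
      = 2 * \<i> * of_real (sin (\<phi> / 2)) * (cis \<gamma> * cis (\<gamma> + \<phi> / 2))"
    using cis_diff[of \<phi> 0] by (simp add: cis_mult)
  ultimately show ?thesis
    by (simp add: arc_to_ray_def)
qed

text \<open>On the arc this is the size of \<open>1 + \<omega>z\<close> relative to
  \<open>1 + z/\<omega>\<close>. When \<open>cos \<gamma> > 0\<close> it is below 1 strictly between
  the ends of the arc, so its powers decay. The computation starts from
  \<open>1 + \<omega> = 2 * cos \<gamma> * cis \<gamma>\<close>.\<close>

lemma norm_rotated_factor_cis:
  "norm (cis \<phi> * (1 + cis (2 * \<gamma>)) - cis (2 * \<gamma>)) ^ 2 =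
    1 - 4 * cos \<gamma> * (cos (\<phi> - \<gamma>) - cos \<gamma>)"
proof -
  have "1 + cis (2 * \<gamma>) = 2 * of_real (cos \<gamma>) * cis \<gamma>"
    by (simp add: complex_eq_iff cos_double_cos sin_double power2_eq_square)
  moreover have "cis (2 * \<gamma>) = cis \<gamma> * cis \<gamma>"
    by (simp add: cis_mult)
  ultimately have "cis \<phi> * (1 + cis (2 * \<gamma>)) - cis (2 * \<gamma>)
      = cis \<gamma> * (2 * of_real (cos \<gamma>) * cis \<phi> - cis \<gamma>)"
    by (simp add: algebra_simps)
  hence "norm (cis \<phi> * (1 + cis (2 * \<gamma>)) - cis (2 * \<gamma>)) ^ 2
      = norm (2 * of_real (cos \<gamma>) * cis \<phi> - cis \<gamma>) ^ 2"
    by (simp add: norm_mult)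
  also have "\<dots> = (2 * cos \<gamma> * cos \<phi> - cos \<gamma>) ^ 2 + (2 * cos \<gamma> * sin \<phi> - sin \<gamma>) ^ 2"
    by (simp add: cmod_power2)
  also have "\<dots> = 4 * cos \<gamma> ^ 2 * (sin \<phi> ^ 2 + cos \<phi> ^ 2) + (sin \<gamma> ^ 2 + cos \<gamma> ^ 2)
      - 4 * cos \<gamma> * (cos \<phi> * cos \<gamma> + sin \<phi> * sin \<gamma>)"
    by (simp add: power2_eq_square algebra_simps del: sin_cos_squared_add sin_cos_squared_add2 sin_cos_squared_add3)
  also have "\<dots> = 1 - 4 * cos \<gamma> * (cos (\<phi> - \<gamma>) - cos \<gamma>)"
    by (simp add: cos_diff power2_eq_square algebra_simps)
  finally show ?thesis .
qed

text \<open>Factoring out \<open>(1 + z/\<omega>)^n\<close> turns the root equation into the one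
  solved by \<open>perturbed_power_root\<close>, the middle term being the perturbation.\<close>

lemma poly_rotated_binomial_poly_arc_to_ray:
  assumes "u \<noteq> cis (2 * \<gamma>)"
  shows "poly (map_poly complex_of_real (rotated_binomial_poly \<gamma> n)) (arc_to_ray \<gamma> u) =
    ((cis (2 * \<gamma>) - 1) / (cis (2 * \<gamma>) - u)) ^ n *
      (2 * u ^ n + 1 + (u * (1 + cis (2 * \<gamma>)) - cis (2 * \<gamma>)) ^ n) / 2"
proof -
  define w where "w = cis (2 * \<gamma>)"
  define v where "v = (w - 1) / (w - u)"
  have nz: "w - u \<noteq> 0" "w \<noteq> 0"
    using assms by (auto simp: w_def)
  have z: "arc_to_ray \<gamma> u = w * (u - 1) / (w - u)"
    by (simp add: arc_to_ray_def w_def)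
  have 1: "1 + arc_to_ray \<gamma> u = v * u"
    using nz by (simp add: z v_def field_simps)
  have 2: "1 + arc_to_ray \<gamma> u * w = v * (u * (1 + w) - w)"
    using nz by (simp add: z v_def field_simps)
  have 3: "1 + arc_to_ray \<gamma> u * cis (- 2 * \<gamma>) = v"
  proof -
    have "w * cis (- 2 * \<gamma>) = 1"
      by (simp add: w_def cis_mult)
    hence eq: "arc_to_ray \<gamma> u * cis (- 2 * \<gamma>) = (u - 1) / (w - u)"
      by (simp add: z)
    show ?thesis
      unfolding eq using nz by (simp add: v_def field_simps)
  qed
  show ?thesis
    unfolding poly_rotated_binomial_poly w_def[symmetric] v_def[symmetric] 1 2 3 power_mult_distrib
    by (simp add: distrib_left add_divide_distrib)
qed

lemma arc_to_ray_inject: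
  assumes "u \<noteq> cis (2 * \<gamma>)" and "v \<noteq> cis (2 * \<gamma>)" and "cis (2 * \<gamma>) \<noteq> 1"
    and "arc_to_ray \<gamma> u = arc_to_ray \<gamma> v"
  shows "u = v"
proof -
  define w where "w = cis (2 * \<gamma>)"
  have "w \<noteq> 0" by (simp add: w_def)
  hence "(u - 1) * (w - v) = (v - 1) * (w - u)"
    using assms by (simp add: arc_to_ray_def flip: w_def) (simp add: divide_simps)
  hence "(u - v) * (w - 1) = 0"
    by (simp add: algebra_simps)
  thus ?thesis
    using assms(3) by (simp add: w_def)
qed

section \<open>Uniform control near the arc\<close>

text \<open>All conditions are open and hold strictly on the compact arc, hence on a uniform
  neighbourhood of it. The ends are cut off by \<open>\<eta>\<close> because the norm tends to 1
  there.\<close>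

lemma arc_neighbourhood:
  assumes \<gamma>: "0 < \<gamma>" "\<gamma> < \<alpha>" "\<alpha> < pi / 2" and \<eta>: "0 < \<eta>" "\<eta> \<le> \<gamma>"
  obtains \<delta> r where "\<delta> > 0" and "0 \<le> r" and "r < 1"
    and "\<And>\<phi> u. \<lbrakk>\<eta> \<le> \<phi>; \<phi> \<le> 2 * \<gamma> - \<eta>; u \<in> cball (cis \<phi>) \<delta>\<rbrakk> \<Longrightarrow>
      u \<noteq> cis (2 * \<gamma>) \<and> norm (u * (1 + cis (2 * \<gamma>)) - cis (2 * \<gamma>)) \<le> r \<and>
      0 < Im (arc_to_ray \<gamma> u) \<and> norm (arc_to_ray \<gamma> u) * cos \<alpha> \<le> Re (arc_to_ray \<gamma> u)"
proof -
  define w where "w = cis (2 * \<gamma>)"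
  \<comment> \<open>\<open>D\<close> is the gap between 1 and the squared norm at the two ends of
    the shortened arc, where the gap is smallest. Halving it in \<open>r\<close> makes the bound
    strict, as the open set \<open>B\<close> requires.\<close>
  define D where "D = 4 * cos \<gamma> * (cos (\<gamma> - \<eta>) - cos \<gamma>)"
  define r where "r = sqrt (1 - D / 2)"
  have cos: "0 < cos \<gamma>" "cos \<alpha> < cos \<gamma>" "cos \<gamma> < cos (\<gamma> - \<eta>)"
    using \<gamma> \<eta> by (auto intro!: cos_gt_zero_pi cos_monotone_0_pi)
  hence D: "D > 0"
    by (simp add: D_def)
  have norm_le: "norm (cis \<phi> * (1 + w) - w) ^ 2 \<le> 1 - D" if "\<eta> \<le> \<phi>" "\<phi> \<le> 2 * \<gamma> - \<eta>" for \<phi>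
  proof -
    have "cos (\<gamma> - \<eta>) \<le> cos \<bar>\<phi> - \<gamma>\<bar>"
      using that \<gamma> \<eta> by (intro cos_monotone_0_pi_le) auto
    hence "D \<le> 4 * cos \<gamma> * (cos (\<phi> - \<gamma>) - cos \<gamma>)"
      using cos by (simp add: D_def)
    thus ?thesis
      unfolding w_def norm_rotated_factor_cis by simp
  qed
  have "0 \<le> 1 - D"
    using norm_le[of \<gamma>] \<eta> by (smt (verit) zero_le_power2)
  hence r: "0 \<le> r" "r < 1"
    using D by (auto simp: r_def)
  define A where "A = cis ` {\<eta>..2 * \<gamma> - \<eta>}"
  define B where "B = {u. norm (u * (1 + w) - w) < r} \<inter>
    (- {w} \<inter> arc_to_ray \<gamma> -` {z. 0 < Im z \<and> norm z * cos \<alpha> < Re z})"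
  have "open B"
  proof -
    have "open (- {w} \<inter> arc_to_ray \<gamma> -` {z. 0 < Im z \<and> norm z * cos \<alpha> < Re z})"
    proof (rule continuous_open_preimage)
      show "continuous_on (- {w}) (arc_to_ray \<gamma>)"
        unfolding arc_to_ray_def by (intro continuous_intros) (auto simp: w_def)
      show "open {z. 0 < Im z \<and> norm z * cos \<alpha> < Re z}"
        by (intro open_Collect_conj open_Collect_less continuous_intros)
      show "open (- {w})"
        by auto
    qed
    thus ?thesis
      unfolding B_def by (rule open_Int[rotated]) (intro open_Collect_less continuous_intros)
  qed
  moreover have "compact A"
    unfolding A_def by (intro compact_continuous_image continuous_intros) auto
  moreover have "A \<subseteq> B"
  proof
    fix u assume "u \<in> A"
    then obtain \<phi> where \<phi>: "u = cis \<phi>" "\<eta> \<le> \<phi>" "\<phi> \<le> 2 * \<gamma> - \<eta>"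
      by (auto simp: A_def)
    have "norm (u * (1 + w) - w) < r"
      unfolding r_def using norm_le[of \<phi>] \<phi> D by (intro real_less_rsqrt) auto
    moreover have "u \<noteq> w"
    proof
      assume "u = w"
      hence "norm (u * (1 + w) - w) = 1"
        by (simp add: w_def algebra_simps norm_mult)
      thus False using \<open>norm (u * (1 + w) - w) < r\<close> r by simp
    qed
    moreover define t where "t = sin (\<phi> / 2) / sin (\<gamma> - \<phi> / 2)"
    have "t > 0"
      unfolding t_def using \<phi> \<gamma> \<eta> by (intro divide_pos_pos sin_gt_zero) auto
    moreover have "arc_to_ray \<gamma> u = of_real t * cis \<gamma>"
      unfolding t_def \<phi>(1) using \<phi> \<gamma> \<eta> by (intro arc_to_ray_cis) auto
    moreover have "sin \<gamma> > 0"
      using \<gamma> by (intro sin_gt_zero) auto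
    ultimately show "u \<in> B"
      using cos by (simp add: B_def norm_mult)
  qed
  ultimately obtain \<delta> where "\<delta> > 0" and "(\<Union>x\<in>A. cball x \<delta>) \<subseteq> B"
    using compact_subset_open_imp_cball_epsilon_subset by metis
  thus ?thesis
    using r by (intro that[of \<delta> r]) (force simp: A_def B_def w_def)+
qed

section \<open>Counting roots in the sector\<close>

lemma card_le_size_filter_proots:
  fixes p :: "'a :: idom poly"
  assumes "p \<noteq> 0" and "A \<subseteq> {z \<in> S. poly p z = 0}"
  shows "card A \<le> size {#z \<in># proots p. z \<in> S#}"
proof -
  have fin: "finite {z \<in> S. poly p z = 0}"
    using poly_roots_finite[OF assms(1)] by simp
  have "card A \<le> (\<Sum>z \<in> {z \<in> S. poly p z = 0}. 1)"
    using card_mono[OF fin assms(2)] by simp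
  also have "\<dots> \<le> (\<Sum>z | z \<in> S \<and> poly p z = 0. order z p)"
    using order_gt_0_iff[OF assms(1)] by (intro sum_mono) (auto simp: Suc_le_eq)
  also have "\<dots> = size {#z \<in># proots p. z \<in> S#}"
    by (rule size_filter_proots[OF assms(1), symmetric])
  finally show ?thesis .
qed

text \<open>The solutions of \<open>2 * u^n = -1\<close> have arguments spaced by
  \<open>2 * pi / n\<close>, so about \<open>n * (\<gamma> - \<eta>) / pi\<close> of them lie over
  an arc of length \<open>2 * (\<gamma> - \<eta>)\<close>. Each yields a root in the upper
  half-plane; conjugation doubles the count, and the -1 is a rounding loss.\<close>

lemma many_roots_in_sector:
  assumes \<gamma>: "0 < \<gamma>" "\<gamma> < \<alpha>" "\<alpha> < pi / 2" and \<eta>: "0 < \<eta>" "\<eta> \<le> \<gamma>"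
  shows "\<forall>\<^sub>F n in sequentially.
    real (size {#z \<in># proots (map_poly complex_of_real (rotated_binomial_poly \<gamma> n)). z \<in> sector \<alpha>#})
      \<ge> 2 * (real n * (\<gamma> - \<eta>) / pi - 1)"
proof -
  define w where "w = cis (2 * \<gamma>)"
  obtain \<delta> r where \<delta>: "\<delta> > 0" and r: "0 \<le> r" "r < 1"
    and nbhd: "\<And>\<phi> u. \<lbrakk>\<eta> \<le> \<phi>; \<phi> \<le> 2 * \<gamma> - \<eta>; u \<in> cball (cis \<phi>) \<delta>\<rbrakk> \<Longrightarrow>
      u \<noteq> w \<and> norm (u * (1 + w) - w) \<le> r \<and>
      0 < Im (arc_to_ray \<gamma> u) \<and> norm (arc_to_ray \<gamma> u) * cos \<alpha> \<le> Re (arc_to_ray \<gamma> u)"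
    using arc_neighbourhood[OF assms] unfolding w_def by metis
  have "((\<lambda>n. r ^ n) \<longlongrightarrow> 0) sequentially"
    using r by (intro LIMSEQ_realpow_zero)
  hence ev_r: "\<forall>\<^sub>F n in sequentially. r ^ n < 1 / 8"
    by (rule order_tendstoD) auto
  \<comment> \<open>This bounds the distance from the unit circle point to the disc's points:
    \<open>1 - \<rho>\<close> radially plus the radius, at most \<open>1/n\<close>.\<close>
  have "((\<lambda>n. 1 - 2 powr (- 1 / real n) + 1 / real n) \<longlongrightarrow> 0) sequentially"
    by real_asymp
  hence ev_\<delta>: "\<forall>\<^sub>F n in sequentially. 1 - 2 powr (- 1 / real n) + 1 / real n < \<delta>"
    using \<delta> by (rule order_tendstoD)
  have "filterlim (\<lambda>n. real n * \<eta>) at_top sequentially"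
    using \<eta> by real_asymp
  hence ev_\<eta>: "\<forall>\<^sub>F n in sequentially. pi \<le> real n * \<eta>"
    by (simp add: filterlim_at_top)
  show ?thesis
    using ev_r ev_\<delta> ev_\<eta> eventually_gt_at_top[of 0]
  proof eventually_elim
    case (elim n)
    define p where "p = map_poly complex_of_real (rotated_binomial_poly \<gamma> n)"
    \<comment> \<open>Polar form of the solutions of \<open>2 * u^n = -1\<close>:
      \<open>n * \<phi> k\<close> is an odd multiple of pi, and the modulus \<open>\<rho>\<close>
      satisfies \<open>\<rho>^n = 1/2\<close>.\<close>
    define \<phi> where "\<phi> = (\<lambda>k::nat. pi * (2 * real k + 1) / real n)"
    define \<rho> where "\<rho> = 2 powr (- 1 / real n)"
    define u0 where "u0 = (\<lambda>k. of_real \<rho> * cis (\<phi> k))"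
    \<comment> \<open>\<open>a\<close> and \<open>b\<close> are the real indices at which
      \<open>\<phi>\<close> would equal \<open>\<eta>\<close> and
      \<open>2 * \<gamma> - \<eta>\<close>. Since \<open>pi \<le> n * \<eta>\<close>,
      \<open>a\<close> is non-negative and \<open>nat\<close> truncates nothing.\<close>
    define a where "a = (real n * \<eta> / pi - 1) / 2"
    define b where "b = (real n * (2 * \<gamma> - \<eta>) / pi - 1) / 2"
    define I where "I = {nat \<lceil>a\<rceil>..nat \<lfloor>b\<rfloor>}"
    have n: "real n > 0"
      using elim by simp
    have \<rho>: "0 < \<rho>" "\<rho> < 1"
      using n by (auto simp: \<rho>_def powr_less_one)
    have norm_u0: "norm (u0 k) = \<rho>" for k
      using \<rho> by (simp add: u0_def norm_mult)
    have "0 \<le> a"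
      using elim by (simp add: a_def field_simps)
    have "a \<le> b"
      unfolding a_def b_def using \<eta> n by (intro divide_right_mono diff_right_mono mult_left_mono) auto
    have \<phi>: "\<eta> \<le> \<phi> k \<and> \<phi> k \<le> 2 * \<gamma> - \<eta>" if "k \<in> I" for k
    proof -
      have "a \<le> real k" "real k \<le> b"
        using that \<open>0 \<le> a\<close> \<open>a \<le> b\<close> by (auto simp: I_def le_nat_iff nat_le_iff) linarith+
      thus ?thesis
        using n by (simp add: a_def b_def \<phi>_def field_simps)
    qed
    have card_I: "real (card I) \<ge> b - a - 1"
      using \<open>0 \<le> a\<close> \<open>a \<le> b\<close> unfolding I_def card_atLeastAtMost by linarith
    have near: "u \<in> cball (cis (\<phi> k)) \<delta>" if "u \<in> cball (u0 k) (\<rho> / n)" for u k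
    proof -
      have "cis (\<phi> k) - u0 k = of_real (1 - \<rho>) * cis (\<phi> k)"
        by (simp add: u0_def algebra_simps)
      hence "dist (cis (\<phi> k)) (u0 k) = 1 - \<rho>"
        using \<rho> by (simp add: dist_norm norm_mult del: of_real_diff)
      moreover have "\<rho> / n \<le> 1 / n"
        using \<rho> n by (intro divide_right_mono) auto
      ultimately have "dist (cis (\<phi> k)) u \<le> 1 - \<rho> + 1 / n"
        using that dist_triangle[of "cis (\<phi> k)" u "u0 k"] by simp
      thus ?thesis
        using elim by (simp add: \<rho>_def)
    qed
    have "\<exists>u. u \<in> ball (u0 k) (\<rho> / n) \<and> 2 * u ^ n + 1 + (u * (1 + w) - w) ^ n = 0" if "k \<in> I" for k
    proof (rule perturbed_power_root[of n "u0 k" "\<lambda>u. (u * (1 + w) - w) ^ n"])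
      show "0 < n"
        using n by simp
      have "real n * \<phi> k = pi + 2 * real k * pi"
        using n by (simp add: \<phi>_def field_simps)
      hence "cis (\<phi> k) ^ n = cis (pi + 2 * real k * pi)"
        by (simp add: Complex.DeMoivre)
      also have "\<dots> = -1"
        by (simp add: complex_eq_iff cos_add sin_add)
      finally have "cis (\<phi> k) ^ n = -1" .
      moreover have "\<rho> ^ n = 1 / 2"
      proof -
        have "\<rho> ^ n = \<rho> powr real n"
          using \<rho> by (simp add: powr_realpow)
        also have "\<dots> = 2 powr - 1"
          using n by (simp add: \<rho>_def powr_powr)
        finally show ?thesis
          by (simp add: powr_minus_divide)
      qed
      hence "complex_of_real \<rho> ^ n = 1 / 2"
        by (metis of_real_power of_real_divide of_real_1 of_real_numeral)
      ultimately show "2 * u0 k ^ n = -1"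
        by (simp only: u0_def power_mult_distrib) simp
      show "norm ((u * (1 + w) - w) ^ n) < 1 / 8" if "u \<in> cball (u0 k) (norm (u0 k) / n)" for u
      proof -
        have "norm (u * (1 + w) - w) \<le> r"
          using nbhd[of "\<phi> k" u] near[of u k] \<phi>[OF \<open>k \<in> I\<close>] that by (simp add: norm_u0)
        hence "norm ((u * (1 + w) - w) ^ n) \<le> r ^ n"
          unfolding norm_power by (intro power_mono) auto
        thus ?thesis using elim by simp
      qed
    qed (auto simp: norm_u0 intro!: holomorphic_intros)
    then obtain U where U: "\<And>k. k \<in> I \<Longrightarrow> U k \<in> ball (u0 k) (\<rho> / n)"
      and U_root: "\<And>k. k \<in> I \<Longrightarrow> 2 * U k ^ n + 1 + (U k * (1 + w) - w) ^ n = 0"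
      by metis
    \<comment> \<open>The discs are disjoint: distinct centres are a chord
      \<open>2 * \<rho> * sin x\<close> apart with \<open>x \<ge> pi/n\<close>, hence at least two
      radii apart.\<close>
    have inj_U: "inj_on U I"
    proof (rule linorder_inj_onI)
      fix k l assume kl: "k < l" "k \<in> I" "l \<in> I"
      define x where "x = (\<phi> l - \<phi> k) / 2"
      have "x = pi * (real l - real k) / n"
        unfolding x_def \<phi>_def diff_divide_distrib[symmetric] using n by (simp add: field_simps)
      moreover have "1 \<le> real l - real k"
        using kl by linarith
      hence "pi * 1 / n \<le> pi * (real l - real k) / n"
        using n by (intro divide_right_mono mult_left_mono) auto
      ultimately have "pi / n \<le> x" by simp
      moreover have "0 < pi / n"
        using n by simp
      moreover have "x \<le> pi / 2"
        using \<phi>[OF kl(2)] \<phi>[OF kl(3)] \<gamma> \<eta> by (simp add: x_def)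
      ultimately have "x / pi \<le> sin x"
        by (intro sin_ge_div_pi) linarith+
      moreover have "1 / n \<le> x / pi"
        using \<open>pi / n \<le> x\<close> by (simp add: field_simps)
      ultimately have "1 / n \<le> \<bar>sin x\<bar>" by simp
      hence "\<rho> * (2 * (1 / n)) \<le> \<rho> * (2 * \<bar>sin x\<bar>)"
        using \<rho> by (intro mult_left_mono) auto
      also have "\<dots> = dist (u0 l) (u0 k)"
      proof -
        have "u0 l - u0 k = of_real \<rho> * (cis (\<phi> l) - cis (\<phi> k))"
          by (simp add: u0_def algebra_simps)
        thus ?thesis
          using \<rho> by (simp add: dist_norm norm_mult cis_diff x_def)
      qed
      finally have "dist (u0 l) (u0 k) \<ge> 2 * (\<rho> / n)" by (simp add: mult.commute)
      thus "U k \<noteq> U l"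
        using U[OF kl(2)] U[OF kl(3)] dist_triangle3[of "u0 l" "u0 k" "U k"]
        by (auto simp: dist_commute)
    qed auto
    define Z where "Z = (\<lambda>k. arc_to_ray \<gamma> (U k))"
    have U': "U k \<noteq> w" "0 < Im (Z k)" "norm (Z k) * cos \<alpha> \<le> Re (Z k)" if "k \<in> I" for k
      using nbhd[of "\<phi> k" "U k"] near[of "U k" k] \<phi>[OF that] U[OF that] by (auto simp: Z_def)
    have "w \<noteq> 1"
    proof
      assume "w = 1"
      hence "sin (2 * \<gamma>) = 0"
        by (simp add: w_def complex_eq_iff)
      moreover have "sin (2 * \<gamma>) > 0"
        using \<gamma> by (intro sin_gt_zero) auto
      ultimately show False by simp
    qed
    hence inj_Z: "inj_on Z I"
      using arc_to_ray_inject[of "U _" \<gamma> "U _"] U'(1) inj_U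
      unfolding inj_on_def Z_def w_def by blast
    have p_root: "poly p (Z k) = 0" if "k \<in> I" for k
      using poly_rotated_binomial_poly_arc_to_ray[of "U k" \<gamma> n] U'(1)[OF that] U_root[OF that]
      by (simp add: p_def Z_def w_def)
    \<comment> \<open>Conjugation swaps the two rotated powers and preserves the third.\<close>
    have p_cnj: "poly p (cnj z) = cnj (poly p z)" for z
      unfolding p_def poly_rotated_binomial_poly by (simp add: cis_cnj)
    have sector: "sector \<alpha> = {z. z \<noteq> 0 \<and> norm z * cos \<alpha> \<le> Re z}"
      using \<gamma> by (intro sector_eq) auto
    have "Z k \<noteq> 0" if "k \<in> I" for k
      using U'(2)[OF that] by auto
    hence "Z ` I \<union> cnj ` Z ` I \<subseteq> {z \<in> sector \<alpha>. poly p z = 0}"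
      using U' p_root by (auto simp: sector p_cnj)
    moreover have "p \<noteq> 0"
      using rotated_binomial_poly_nonzero by (simp add: p_def map_poly_eq_0_iff)
    ultimately have "card (Z ` I \<union> cnj ` Z ` I) \<le> size {#z \<in># proots p. z \<in> sector \<alpha>#}"
      by (intro card_le_size_filter_proots)
    moreover have "card (Z ` I \<union> cnj ` Z ` I) = card (Z ` I) + card (cnj ` Z ` I)"
    proof (rule card_Un_disjoint)
      have "Im (Z k) \<noteq> - Im (Z l)" if "k \<in> I" "l \<in> I" for k l
        using U'(2)[OF that(1)] U'(2)[OF that(2)] by linarith
      hence "Z k \<noteq> cnj (Z l)" if "k \<in> I" "l \<in> I" for k l
        using that by (metis cnj.sel(2))
      thus "Z ` I \<inter> cnj ` Z ` I = {}"
        by blast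
    qed (auto simp: I_def)
    moreover have "card (Z ` I) = card I" "card (cnj ` Z ` I) = card I"
      using inj_Z by (auto simp: card_image inj_on_def)
    ultimately have "2 * real (card I) \<le> real (size {#z \<in># proots p. z \<in> sector \<alpha>#})"
      by linarith
    moreover have "b - a = real n * (\<gamma> - \<eta>) / pi"
      by (simp add: a_def b_def field_simps)
    ultimately have "2 * (real n * (\<gamma> - \<eta>) / pi - 1)
        \<le> real (size {#z \<in># proots p. z \<in> sector \<alpha>#})"
      using card_I by (metis mult_left_mono order_trans zero_le_numeral)
    thus ?case
      by (simp only: p_def)
  qed
qed

section \<open>Choice of parameters and conclusion\<close>

theorem mainTheorem4:
  fixes \<alpha> c :: real
  assumes "0 < \<alpha>" and "\<alpha> < pi / 2" and "c < 2 * \<alpha> / pi"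
  shows "(\<exists>P :: real poly. degree P \<ge> 1 \<and> (\<forall>i. coeff P i \<ge> 0) \<and>
            real (size {#z \<in># proots (map_poly complex_of_real P). z \<in> sector \<alpha>#})
              > c * real (degree P))
       \<and> \<not> (\<forall>P :: real poly. degree P \<ge> 1 \<and> (\<forall>i. coeff P i \<ge> 0) \<longrightarrow>
            measure (empirical_measure (map_poly complex_of_real P)) (sector \<alpha>) \<le> c)"
proof -
  \<comment> \<open>A non-negative constant is needed to pass from \<open>n\<close> to the possibly
    smaller degree.\<close>
  define c' where "c' = max c 0"
  \<comment> \<open>With \<open>c' * pi / 2 < \<kappa> < \<gamma> < \<alpha>\<close> and
    \<open>\<eta> = \<gamma> - \<kappa>\<close>, the count is at least
    \<open>2 * n * \<kappa> / pi - 2\<close>, whose slope exceeds \<open>c'\<close>.\<close>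
  define \<kappa> where "\<kappa> = (c' * pi / 2 + \<alpha>) / 2"
  define \<gamma> where "\<gamma> = (\<kappa> + \<alpha>) / 2"
  have "c' * pi / 2 < \<alpha>" "0 \<le> c'"
    using assms by (auto simp: c'_def max_def field_simps)
  hence \<kappa>: "c' * pi / 2 < \<kappa>" "\<kappa> < \<alpha>" "0 < \<kappa>"
    using assms by (auto simp: \<kappa>_def add_nonneg_pos)
  have "\<forall>\<^sub>F n in sequentially.
      real (size {#z \<in># proots (map_poly complex_of_real (rotated_binomial_poly \<gamma> n)). z \<in> sector \<alpha>#})
        \<ge> 2 * (real n * (\<gamma> - (\<gamma> - \<kappa>)) / pi - 1)"
    using \<kappa> assms by (intro many_roots_in_sector) (auto simp: \<gamma>_def)
  moreover have "2 * \<kappa> / pi - c' > 0"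
    using \<kappa> by (simp add: field_simps)
  hence "filterlim (\<lambda>n. (2 * \<kappa> / pi - c') * real n) at_top sequentially"
    by real_asymp
  hence "\<forall>\<^sub>F n in sequentially. (2 * \<kappa> / pi - c') * real n > 2"
    by (simp add: filterlim_at_top_dense)
  ultimately obtain n where n: "2 * (real n * \<kappa> / pi - 1)
        \<le> real (size {#z \<in># proots (map_poly complex_of_real (rotated_binomial_poly \<gamma> n)). z \<in> sector \<alpha>#})"
      "(2 * \<kappa> / pi - c') * real n > 2"
    using eventually_happens'[OF sequentially_bot eventually_conj] by force
  define P where "P = rotated_binomial_poly \<gamma> n"
  define p where "p = map_poly complex_of_real P"
  define s where "s = real (size {#z \<in># proots p. z \<in> sector \<alpha>#})"
  have [simp]: "degree p = degree P"
    by (simp add: p_def degree_map_poly)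
  have "c' * real n < s"
    using n by (simp add: s_def p_def P_def algebra_simps)
  moreover have "c' * real (degree P) \<le> c' * real n"
    using \<open>0 \<le> c'\<close> degree_rotated_binomial_poly_le[of \<gamma> n] by (intro mult_left_mono) (auto simp: P_def)
  moreover have "c * real (degree P) \<le> c' * real (degree P)"
    by (intro mult_right_mono) (auto simp: c'_def)
  ultimately have s: "0 < s" "c * real (degree P) < s"
    using \<open>0 \<le> c'\<close> by (auto simp: order_le_less_trans[of 0 "c' * real n" s])
  \<comment> \<open>Non-constancy comes from the positive root count.\<close>
  have "s \<le> real (size (proots p))"
    unfolding s_def by (intro of_nat_mono size_mset_mono multiset_filter_subset)
  hence deg: "degree P \<ge> 1"
    using s size_proots_le[of p] by auto
  have "measure (empirical_measure p) (sector \<alpha>) = s / real (degree P)"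
    unfolding s_def using deg assms by (subst measure_empirical_measure) (auto intro: sector_borel)
  hence "measure (empirical_measure p) (sector \<alpha>) > c"
    using s deg by (simp add: pos_less_divide_eq)
  moreover have "\<forall>i. coeff P i \<ge> 0"
    by (simp add: P_def coeff_rotated_binomial_poly_nonneg)
  ultimately show ?thesis
    using s deg unfolding s_def p_def by (meson not_le)
qed

end
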